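(* Let $n$ be a non-negative integer and let $q,b,d$ be non-zero complex numbers, with $\sqrt q$ a fixed square root of $q$. Then each of the following two identities holds whenever no denominator on either side of it vanishes: $${}_4\phi_3\left[\begin{matrix} q^{-n},\ b,\ b\sqrt q,\ d^2q^n\\ dq,\ d\sqrt q,\ b^2\end{matrix};q,q\right]=\frac{b^n(1-d)\,(-\sqrt q,\ d\sqrt q/b;\sqrt q)_n}{(1-q^nd)\,(-b,\ d;\sqrt q)_n}$$ and $${}_4\phi_3\left[\begin{matrix} q^{-n},\ b,\ b\sqrt q,\ d^2q^{n+1}\\ dq,\ d\sqrt q,\ b^2q\end{matrix};q,q\right]=\frac{b^n\,(-\sqrt q,\ d\sqrt q/b;\sqrt q)_n}{(-b\sqrt q,\ d\sqrt q;\sqrt q)_n} .$$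
   Context: For complex $a,q$ and a non-negative integer $n$, $(a;q)_n:=\prod_{k=0}^{n-1}(1-aq^k)$, with $(a;q)_0=1$, and $(a_1,\ldots,a_k;q)_n:=\prod_{i=1}^k (a_i;q)_n$; the same notation with $\sqrt q$ in place of $q$ gives $(a;\sqrt q)_n=\prod_{k=0}^{n-1}(1-a(\sqrt q)^k)$. The unilateral basic hypergeometric series is $${}_{r+1}\phi_r\left[\begin{matrix} a_0,\ldots,a_r\\ b_1,\ldots,b_r\end{matrix};q,z\right]:=\sum_{j=0}^{\infty}\frac{(a_0,\ldots,a_r;q)_j}{(q,b_1,\ldots,b_r;q)_j}z^j .$$ When one numerator parameter is $q^{-n}$ the series terminates and is read as the finite sum over $0\le j\le n$ (so no convergence condition on $z$ is needed). *)

theory Defs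
  imports "HOL-Analysis.Analysis"
begin

definition qpoch :: "complex \<Rightarrow> complex \<Rightarrow> nat \<Rightarrow> complex" where
  "qpoch a q n = (\<Prod>k<n. 1 - a * q ^ k)"

definition qpochs :: "complex list \<Rightarrow> complex \<Rightarrow> nat \<Rightarrow> complex" where
  "qpochs as q n = (\<Prod>a\<leftarrow>as. qpoch a q n)"

(* The series is written r+1_phi_r when length as = r + 1 and length bs = r.
   If q^(-n) is among the numerator parameters, every term of index j > n has numerator 0,
   hence is 0 in HOL even where its denominator vanishes (0 / 0 = 0); so the series is then
   the finite sum over j <= n, see basic_hyp_terminating. *)
definition basic_hyp :: "complex list \<Rightarrow> complex list \<Rightarrow> complex \<Rightarrow> complex \<Rightarrow> complex" where
  "basic_hyp as bs q z = (\<Sum>j. qpochs as q j / qpochs (q # bs) q j * z ^ j)"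

lemma basic_hyp_terminating:
  assumes "q \<noteq> 0" and "q powi (- int n) \<in> set as"
  shows "basic_hyp as bs q z = (\<Sum>j\<le>n. qpochs as q j / qpochs (q # bs) q j * z ^ j)"
  unfolding basic_hyp_def
proof (rule suminf_finite)
  fix j assume "j \<notin> {..n}"
  then have "n < j" by simp
  have "1 - q powi (- int n) * q ^ n = 0"
    using assms(1) by (simp add: power_int_minus)
  with \<open>n < j\<close> have "qpoch (q powi (- int n)) q j = 0"
    unfolding qpoch_def by (intro prod_zero) auto
  then have "qpochs as q j = 0"
    using assms(2) unfolding qpochs_def by (force simp: prod_list_zero_iff)
  then show "qpochs as q j / qpochs (q # bs) q j * z ^ j = 0" by simp
qed simp

end

theory Submission
  imports Defs
begin

text \<open>
  Put \<open>q = s\<^sup>2\<close>.  Since \<open>(b;q)\<^sub>j (b s;q)\<^sub>j = (b;s)\<^sub>2\<^sub>j\<close>, both series are instances of one sum with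
  general term
    \<open>(q\<^sup>-\<^sup>n;q)\<^sub>j (a;q)\<^sub>j (b;s)\<^sub>2\<^sub>j / ((q;q)\<^sub>j (e;s)\<^sub>2\<^sub>j (c;q)\<^sub>j) q\<^sup>j\<close>,  \<open>e = d s\<close>.
  Write \<open>A\<^sub>n(b,d)\<close> for the first series (\<open>a = d\<^sup>2 q\<^sup>n\<close>, \<open>c = b\<^sup>2\<close>) and \<open>B\<^sub>n(b,d)\<close> for the second
  (\<open>a = d\<^sup>2 q\<^sup>n\<^sup>+\<^sup>1\<close>, \<open>c = b\<^sup>2 q\<close>).

  The two families determine each other by induction on \<open>n\<close>.  If two general terms differ by moving
  a power of \<open>s\<close> between suitable parameters, their difference has a factor \<open>1 - q\<^sup>j\<close>.  This factor
  kills the term \<open>j = 0\<close> and cancels the last factor of \<open>(q;q)\<^sub>j\<close>, so that after replacing \<open>j\<close> by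
  \<open>j + 1\<close> one again has a general term of the same shape.  Two such moves suffice:
    \<open>B\<^sub>n\<^sub>+\<^sub>1(b,d) = B\<^sub>n(b,d) - K A\<^sub>n(b q, d q)\<close>,
    \<open>A\<^sub>n\<^sub>+\<^sub>1(b,d) = B\<^sub>n\<^sub>+\<^sub>1(b/s, d/s) + K' A\<^sub>n(b s, d q)\<close>,
  with explicit rational \<open>K\<close> and \<open>K'\<close>
  (\<open>quad_sum_contiguous_na\<close> and \<open>quad_sum_contiguous_be\<close>).  The claimed products satisfy the same two
  relations (\<open>value_b2q_Suc\<close> and \<open>value_b2_Suc\<close>), and everything equals 1 at \<open>n = 0\<close>.

  Neither relation divides by anything that could vanish while the denominators of its left-hand side
  do not, and every sum on a right-hand side inherits nonvanishing denominators from the left-hand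
  side; this is why the induction can be run at the given parameters directly.
\<close>

section \<open>Shifted factorials\<close>

lemma qpoch_0 [simp]: "qpoch a q 0 = 1"
  by (simp add: qpoch_def)

lemma qpoch_Suc: "qpoch a q (Suc n) = qpoch a q n * (1 - a * q ^ n)"
  by (simp add: qpoch_def)

lemma qpoch_Suc_shift: "qpoch a q (Suc n) = (1 - a) * qpoch (a * q) q n"
  unfolding qpoch_def by (subst prod.lessThan_Suc_shift) (simp add: mult_ac)

lemma qpoch_eq_0_iff: "qpoch a q n = 0 \<longleftrightarrow> (\<exists>k<n. a * q ^ k = 1)"
  by (auto simp: qpoch_def)

lemma qpoch_nonzero_mono: "qpoch a q n \<noteq> 0 \<Longrightarrow> m \<le> n \<Longrightarrow> qpoch a q m \<noteq> 0"
  by (auto simp: qpoch_eq_0_iff)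

lemma qpoch_double: "qpoch a s (2 * n) = qpoch a (s\<^sup>2) n * qpoch (a * s) (s\<^sup>2) n"
  by (induction n) (simp_all add: qpoch_Suc power_mult [symmetric] mult_ac)

lemma qpoch_square: "qpoch (a\<^sup>2) (s\<^sup>2) n = qpoch a s n * qpoch (- a) s n"
  by (induction n) (simp_all add: qpoch_Suc algebra_simps power2_eq_square power_mult_distrib)

section \<open>Contiguous relations for the general term\<close>

definition quad_term :: "complex \<Rightarrow> complex \<Rightarrow> complex \<Rightarrow> complex \<Rightarrow> complex \<Rightarrow> complex \<Rightarrow> nat \<Rightarrow> complex" where
  "quad_term s r a b e c j =
     qpoch r (s\<^sup>2) j * qpoch a (s\<^sup>2) j * qpoch b s (2 * j) /
     (qpoch (s\<^sup>2) (s\<^sup>2) j * qpoch e s (2 * j) * qpoch c (s\<^sup>2) j) * (s\<^sup>2) ^ j"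

lemma quad_term_0 [simp]: "quad_term s r a b e c 0 = 1"
  by (simp add: quad_term_def)

text \<open>
  Raising \<open>a\<close> or raising \<open>r\<close> by a factor \<open>q = s\<^sup>2\<close> changes the term by the linear factors
  \<open>(1 - r) (1 - a q\<^sup>j)\<close> and \<open>(1 - r q\<^sup>j) (1 - a)\<close>; they agree at \<open>q\<^sup>j = 1\<close>, so
  their difference is a multiple of \<open>1 - q\<^sup>j\<close>.  The index \<open>Suc j\<close> records the subsequent shift.
\<close>
lemma quad_term_contiguous_ra:
  assumes "qpoch (s\<^sup>2) (s\<^sup>2) (Suc j) \<noteq> 0" "qpoch e s (2 * Suc j) \<noteq> 0" "qpoch c (s\<^sup>2) (Suc j) \<noteq> 0"
  shows "quad_term s r (a * s\<^sup>2) b e c (Suc j) - quad_term s (r * s\<^sup>2) a b e c (Suc j) =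
    - (s\<^sup>2 * (r - a) * (1 - b) * (1 - b * s) / ((1 - e) * (1 - e * s) * (1 - c))) *
    quad_term s (r * s\<^sup>2) (a * s\<^sup>2) (b * s\<^sup>2) (e * s\<^sup>2) (c * s\<^sup>2) j"
proof -
  define x where "x = (s\<^sup>2) ^ j"
  define R where "R = qpoch (r * s\<^sup>2) (s\<^sup>2) j"
  define A where "A = qpoch (a * s\<^sup>2) (s\<^sup>2) j"
  define B where "B = qpoch (b * s\<^sup>2) s (2 * j)"
  define E where "E = qpoch (e * s\<^sup>2) s (2 * j)"
  define C where "C = qpoch (c * s\<^sup>2) (s\<^sup>2) j"
  define Q where "Q = qpoch (s\<^sup>2) (s\<^sup>2) j"
  have double: "qpoch a s (2 * Suc j) = (1 - a) * (1 - a * s) * qpoch (a * s\<^sup>2) s (2 * j)" for a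
    by (simp add: qpoch_Suc_shift power2_eq_square mult.assoc)
  have *: "qpoch b s (2 * Suc j) = (1 - b) * (1 - b * s) * B"
    "qpoch e s (2 * Suc j) = (1 - e) * (1 - e * s) * E"
    "qpoch c (s\<^sup>2) (Suc j) = (1 - c) * C"
    "qpoch (s\<^sup>2) (s\<^sup>2) (Suc j) = Q * (1 - s\<^sup>2 * x)"
    "qpoch r (s\<^sup>2) (Suc j) = (1 - r) * R" "qpoch a (s\<^sup>2) (Suc j) = (1 - a) * A"
    "qpoch (r * s\<^sup>2) (s\<^sup>2) (Suc j) = R * (1 - r * s\<^sup>2 * x)"
    "qpoch (a * s\<^sup>2) (s\<^sup>2) (Suc j) = A * (1 - a * s\<^sup>2 * x)"
    unfolding double B_def E_def C_def R_def A_def Q_def x_def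
    by (simp_all only: qpoch_Suc_shift [of c] qpoch_Suc_shift [of r] qpoch_Suc_shift [of a]
        qpoch_Suc [of "s\<^sup>2"] qpoch_Suc [of "_ * s\<^sup>2"] power_Suc mult.assoc)
  have nz: "1 - e \<noteq> 0" "1 - e * s \<noteq> 0" "E \<noteq> 0" "1 - c \<noteq> 0" "C \<noteq> 0" "Q \<noteq> 0" "1 - s\<^sup>2 * x \<noteq> 0"
    using assms unfolding * by auto
  have "quad_term s r (a * s\<^sup>2) b e c (Suc j) - quad_term s (r * s\<^sup>2) a b e c (Suc j) =
     R * A * B * (1 - b) * (1 - b * s) * s\<^sup>2 * x / ((1 - e) * (1 - e * s) * E * (1 - c) * C * Q * (1 - s\<^sup>2 * x)) *
     ((1 - r) * (1 - a * s\<^sup>2 * x) - (1 - r * s\<^sup>2 * x) * (1 - a))"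
    unfolding quad_term_def * power_Suc x_def [symmetric] using nz
    by (simp add: divide_simps) (simp add: algebra_simps)
  also have "(1 - r) * (1 - a * s\<^sup>2 * x) - (1 - r * s\<^sup>2 * x) * (1 - a) = - (1 - s\<^sup>2 * x) * (r - a)"
    by (simp add: algebra_simps)
  also have "R * A * B * (1 - b) * (1 - b * s) * s\<^sup>2 * x / ((1 - e) * (1 - e * s) * E * (1 - c) * C * Q * (1 - s\<^sup>2 * x)) *
      (- (1 - s\<^sup>2 * x) * (r - a)) =
    - (s\<^sup>2 * (r - a) * (1 - b) * (1 - b * s) / ((1 - e) * (1 - e * s) * (1 - c))) *
      (R * A * B / (Q * E * C) * x)"
    using nz by (simp add: divide_simps) (simp add: algebra_simps)
  finally show ?thesis
    unfolding quad_term_def R_def A_def B_def E_def C_def Q_def x_def .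
qed

text \<open>
  The quotients \<open>(b s;s)\<^sub>2\<^sub>j / (b;s)\<^sub>2\<^sub>j = (1 - b q\<^sup>j) / (1 - b)\<close> and the analogous ones for \<open>e\<close> are
  linear in \<open>q\<^sup>j\<close>.  The two terms are therefore a common expression times
  \<open>(1 - b q\<^sup>j) (1 - e)\<close> and \<open>(1 - b) (1 - e q\<^sup>j)\<close>, which again agree at \<open>q\<^sup>j = 1\<close>.
  The common denominator of \<open>(e;s)\<^sub>2\<^sub>j\<close> and \<open>(e s;s)\<^sub>2\<^sub>j\<close> is \<open>(e;s)\<^sub>2\<^sub>j\<^sub>+\<^sub>1\<close>; after the shift it
  splits off three factors, which is where \<open>e s\<^sup>3\<close> comes from.
\<close>
lemma quad_term_contiguous_be:
  assumes "qpoch (s\<^sup>2) (s\<^sup>2) (Suc j) \<noteq> 0" "qpoch e s (2 * j + 3) \<noteq> 0" "qpoch c (s\<^sup>2) (Suc j) \<noteq> 0"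
  shows "quad_term s r a (b * s) (e * s) c (Suc j) - quad_term s r a b e c (Suc j) =
    s\<^sup>2 * (b - e) * (1 - r) * (1 - a) * (1 - b * s) /
      ((1 - e) * (1 - e * s) * (1 - e * s\<^sup>2) * (1 - c)) *
    quad_term s (r * s\<^sup>2) (a * s\<^sup>2) (b * s\<^sup>2) (e * s ^ 3) (c * s\<^sup>2) j"
proof -
  define x where "x = (s\<^sup>2) ^ j"
  define R where "R = qpoch (r * s\<^sup>2) (s\<^sup>2) j"
  define A where "A = qpoch (a * s\<^sup>2) (s\<^sup>2) j"
  define B where "B = qpoch (b * s\<^sup>2) s (2 * j)"
  define E where "E = qpoch (e * s ^ 3) s (2 * j)"
  define C where "C = qpoch (c * s\<^sup>2) (s\<^sup>2) j"
  define Q where "Q = qpoch (s\<^sup>2) (s\<^sup>2) j"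
  have x: "s ^ (2 * j) = x" "(s * s) ^ j = x"
    by (simp_all add: x_def power_mult power2_eq_square)
  have *: "qpoch b s (2 * Suc j) = (1 - b) * (1 - b * s) * B"
    "qpoch (b * s) s (2 * Suc j) = (1 - b * s) * B * (1 - b * s\<^sup>2 * x)"
    "qpoch (e * s) s (2 * Suc j) = (1 - e * s) * (1 - e * s\<^sup>2) * E"
    "qpoch c (s\<^sup>2) (Suc j) = (1 - c) * C"
    "qpoch (s\<^sup>2) (s\<^sup>2) (Suc j) = Q * (1 - s\<^sup>2 * x)"
    "qpoch r (s\<^sup>2) (Suc j) = (1 - r) * R" "qpoch a (s\<^sup>2) (Suc j) = (1 - a) * A"
    using qpoch_Suc_shift [of "b * s" s "Suc (2 * j)"] qpoch_Suc [of "b * s\<^sup>2" s "2 * j"]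
      qpoch_Suc_shift [of "e * s" s "Suc (2 * j)"] qpoch_Suc_shift [of "e * s\<^sup>2" s "2 * j"]
      qpoch_Suc_shift [of b s "Suc (2 * j)"] qpoch_Suc_shift [of "b * s" s "2 * j"]
    by (simp_all add: B_def E_def C_def R_def A_def Q_def x x_def [symmetric] power2_eq_square
        power3_eq_cube mult.assoc qpoch_Suc_shift [of c] qpoch_Suc_shift [of r]
        qpoch_Suc_shift [of a] qpoch_Suc [of "s * s"])
  have **: "qpoch e s (2 * j + 3) = (1 - e) * (1 - e * s) * (1 - e * s\<^sup>2) * E"
    "qpoch e s (2 * j + 3) = qpoch e s (2 * Suc j) * (1 - e * s\<^sup>2 * x)"
    using qpoch_Suc_shift [of e s "Suc (Suc (2 * j))"] qpoch_Suc_shift [of "e * s" s "Suc (2 * j)"]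
      qpoch_Suc_shift [of "e * s\<^sup>2" s "2 * j"] qpoch_Suc [of e s "Suc (Suc (2 * j))"]
    by (simp_all add: E_def x power2_eq_square power3_eq_cube mult.assoc numeral_3_eq_3)
  have nz: "1 - e \<noteq> 0" "1 - e * s \<noteq> 0" "1 - e * s\<^sup>2 \<noteq> 0" "E \<noteq> 0" "1 - c \<noteq> 0" "C \<noteq> 0" "Q \<noteq> 0"
    "1 - s\<^sup>2 * x \<noteq> 0" "1 - e * s\<^sup>2 * x \<noteq> 0"
    using assms ** unfolding * by auto
  have e: "qpoch e s (2 * Suc j) = (1 - e) * (1 - e * s) * (1 - e * s\<^sup>2) * E / (1 - e * s\<^sup>2 * x)"
    using ** nz by (simp add: divide_simps)
  have "quad_term s r a (b * s) (e * s) c (Suc j) - quad_term s r a b e c (Suc j) =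
     (1 - r) * R * (1 - a) * A * (1 - b * s) * B * s\<^sup>2 * x /
     (Q * (1 - s\<^sup>2 * x) * (1 - e) * (1 - e * s) * (1 - e * s\<^sup>2) * E * (1 - c) * C) *
     ((1 - b * s\<^sup>2 * x) * (1 - e) - (1 - b) * (1 - e * s\<^sup>2 * x))"
    unfolding quad_term_def * e power_Suc x_def [symmetric] using nz
    by (simp add: divide_simps) (simp add: algebra_simps)
  also have "(1 - b * s\<^sup>2 * x) * (1 - e) - (1 - b) * (1 - e * s\<^sup>2 * x) = (1 - s\<^sup>2 * x) * (b - e)"
    by (simp add: algebra_simps)
  also have "(1 - r) * R * (1 - a) * A * (1 - b * s) * B * s\<^sup>2 * x /
     (Q * (1 - s\<^sup>2 * x) * (1 - e) * (1 - e * s) * (1 - e * s\<^sup>2) * E * (1 - c) * C) *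
     ((1 - s\<^sup>2 * x) * (b - e)) =
    s\<^sup>2 * (b - e) * (1 - r) * (1 - a) * (1 - b * s) /
      ((1 - e) * (1 - e * s) * (1 - e * s\<^sup>2) * (1 - c)) * (R * A * B / (Q * E * C) * x)"
    using nz by (simp add: divide_simps)
  finally show ?thesis
    unfolding quad_term_def R_def A_def B_def E_def C_def Q_def x_def .
qed

section \<open>Contiguous relations for the sums\<close>

definition quad_sum :: "complex \<Rightarrow> nat \<Rightarrow> complex \<Rightarrow> complex \<Rightarrow> complex \<Rightarrow> complex \<Rightarrow> complex" where
  "quad_sum s n a b e c = (\<Sum>j\<le>n. quad_term s (inverse ((s\<^sup>2) ^ n)) a b e c j)"

text \<open>
  Raising \<open>n\<close> lowers the parameter \<open>q\<^sup>-\<^sup>n\<close>, so this is the sum of \<open>quad_term_contiguous_ra\<close>;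
  with \<open>a = d\<^sup>2 q\<^sup>n\<^sup>+\<^sup>1\<close> it compares consecutive members of the second family.
\<close>
lemma quad_sum_contiguous_na:
  assumes "s \<noteq> 0" "qpoch (s\<^sup>2) (s\<^sup>2) (Suc n) \<noteq> 0" "qpoch e s (2 * Suc n) \<noteq> 0"
    "qpoch c (s\<^sup>2) (Suc n) \<noteq> 0"
  shows "quad_sum s (Suc n) (a * s\<^sup>2) b e c = quad_sum s n a b e c
    - s\<^sup>2 * (inverse ((s\<^sup>2) ^ Suc n) - a) * (1 - b) * (1 - b * s) / ((1 - e) * (1 - e * s) * (1 - c)) *
      quad_sum s n (a * s\<^sup>2) (b * s\<^sup>2) (e * s\<^sup>2) (c * s\<^sup>2)"
proof -
  define r where "r = inverse ((s\<^sup>2) ^ Suc n)"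
  define K where "K = s\<^sup>2 * (r - a) * (1 - b) * (1 - b * s) / ((1 - e) * (1 - e * s) * (1 - c))"
  have r: "inverse ((s\<^sup>2) ^ n) = r * s\<^sup>2"
    using assms(1) by (simp add: r_def field_simps)
  \<comment> \<open>Both sums can run up to \<open>Suc n\<close>, because the shorter one acquires only a zero term.\<close>
  have "qpoch (r * s\<^sup>2) (s\<^sup>2) (Suc n) = 0"
    using assms(1) by (simp add: qpoch_Suc flip: r)
  then have "quad_term s (r * s\<^sup>2) a b e c (Suc n) = 0"
    by (simp add: quad_term_def)
  then have "quad_sum s n a b e c = (\<Sum>j\<le>Suc n. quad_term s (r * s\<^sup>2) a b e c j)"
    by (simp add: quad_sum_def r)
  then have "quad_sum s (Suc n) (a * s\<^sup>2) b e c - quad_sum s n a b e c =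
      (\<Sum>j\<le>n. quad_term s r (a * s\<^sup>2) b e c (Suc j) - quad_term s (r * s\<^sup>2) a b e c (Suc j))"
    by (simp add: quad_sum_def r_def sum.atMost_Suc_shift sum_subtractf del: sum.atMost_Suc power_Suc)
  also have "\<dots> = (\<Sum>j\<le>n. - K * quad_term s (r * s\<^sup>2) (a * s\<^sup>2) (b * s\<^sup>2) (e * s\<^sup>2) (c * s\<^sup>2) j)"
    using assms
    unfolding K_def by (intro sum.cong quad_term_contiguous_ra) (auto elim!: qpoch_nonzero_mono)
  also have "\<dots> = - K * quad_sum s n (a * s\<^sup>2) (b * s\<^sup>2) (e * s\<^sup>2) (c * s\<^sup>2)"
    by (simp only: quad_sum_def r sum_distrib_left)
  finally show ?thesis
    unfolding r_def [symmetric] K_def [symmetric] by (simp add: algebra_simps)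
qed

text \<open>
  Applied to \<open>b/s\<close> and \<open>e = d\<close>, this carries the second family to the first: \<open>(b/s)\<^sup>2 q = b\<^sup>2\<close> and
  \<open>(d/s)\<^sup>2 q\<^sup>n\<^sup>+\<^sup>1 = d\<^sup>2 q\<^sup>n\<close>, so the parameters \<open>a\<close> and \<open>c\<close> need no change.
\<close>
lemma quad_sum_contiguous_be:
  assumes "s \<noteq> 0" "qpoch (s\<^sup>2) (s\<^sup>2) (Suc n) \<noteq> 0" "qpoch e s (2 * n + 3) \<noteq> 0"
    "qpoch c (s\<^sup>2) (Suc n) \<noteq> 0"
  shows "quad_sum s (Suc n) a (b * s) (e * s) c = quad_sum s (Suc n) a b e c
    + s\<^sup>2 * (b - e) * (1 - inverse ((s\<^sup>2) ^ Suc n)) * (1 - a) * (1 - b * s) /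
        ((1 - e) * (1 - e * s) * (1 - e * s\<^sup>2) * (1 - c)) *
      quad_sum s n (a * s\<^sup>2) (b * s\<^sup>2) (e * s ^ 3) (c * s\<^sup>2)"
proof -
  define r where "r = inverse ((s\<^sup>2) ^ Suc n)"
  define K where "K = s\<^sup>2 * (b - e) * (1 - r) * (1 - a) * (1 - b * s) /
        ((1 - e) * (1 - e * s) * (1 - e * s\<^sup>2) * (1 - c))"
  have r: "inverse ((s\<^sup>2) ^ n) = r * s\<^sup>2"
    using assms(1) by (simp add: r_def field_simps)
  have "quad_sum s (Suc n) a (b * s) (e * s) c - quad_sum s (Suc n) a b e c =
      (\<Sum>j\<le>n. quad_term s r a (b * s) (e * s) c (Suc j) - quad_term s r a b e c (Suc j))"
    by (simp add: quad_sum_def r_def sum.atMost_Suc_shift sum_subtractf del: sum.atMost_Suc power_Suc)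
  also have "\<dots> = (\<Sum>j\<le>n. K * quad_term s (r * s\<^sup>2) (a * s\<^sup>2) (b * s\<^sup>2) (e * s ^ 3) (c * s\<^sup>2) j)"
    using assms
    unfolding K_def by (intro sum.cong quad_term_contiguous_be) (auto elim!: qpoch_nonzero_mono)
  also have "\<dots> = K * quad_sum s n (a * s\<^sup>2) (b * s\<^sup>2) (e * s ^ 3) (c * s\<^sup>2)"
    by (simp only: quad_sum_def r sum_distrib_left)
  finally show ?thesis
    unfolding r_def [symmetric] K_def [symmetric] by (simp add: algebra_simps)
qed

section \<open>Contiguous relations for the products\<close>

text \<open>
  The products in the two identities, named after the last denominator parameter of the series,
  \<open>b\<^sup>2\<close> or \<open>b\<^sup>2 q\<close>.
\<close>
definition value_b2 :: "complex \<Rightarrow> nat \<Rightarrow> complex \<Rightarrow> complex \<Rightarrow> complex" where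
  "value_b2 s n b d = b ^ n * (1 - d) * (qpoch (- s) s n * qpoch (d * s / b) s n) /
     ((1 - (s\<^sup>2) ^ n * d) * (qpoch (- b) s n * qpoch d s n))"

definition value_b2q :: "complex \<Rightarrow> nat \<Rightarrow> complex \<Rightarrow> complex \<Rightarrow> complex" where
  "value_b2q s n b d = b ^ n * (qpoch (- s) s n * qpoch (d * s / b) s n) /
     (qpoch (- (b * s)) s n * qpoch (d * s) s n)"

text \<open>
  With \<open>S = s\<^sup>n\<close> and without the common factor \<open>value_b2q s n b d\<close>, the relation becomes
  \<open>(1 + s S) (b - d s S) = (1 + b s S) (1 - d s S) - (1 + d s\<^sup>2 S\<^sup>2) (1 - b)\<close>.
  The condition on \<open>(b\<^sup>2 s\<^sup>2;s\<^sup>2)\<close> is what makes \<open>(- b s;s)\<close> nonzero, since it is the product of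
  \<open>(b s;s)\<close> and \<open>(- b s;s)\<close>.
\<close>
lemma value_b2q_Suc:
  assumes "s \<noteq> 0" "b \<noteq> 0" "qpoch (d * s) s (2 * Suc n) \<noteq> 0" "qpoch (b\<^sup>2 * s\<^sup>2) (s\<^sup>2) (Suc n) \<noteq> 0"
  shows "value_b2q s (Suc n) b d = value_b2q s n b d
    - s\<^sup>2 * (inverse ((s\<^sup>2) ^ Suc n) - d\<^sup>2 * (s\<^sup>2) ^ Suc n) * (1 - b) * (1 - b * s) /
        ((1 - d * s) * (1 - d * s * s) * (1 - b\<^sup>2 * s\<^sup>2)) *
      value_b2 s n (b * s\<^sup>2) (d * s\<^sup>2)"
proof -
  define S where "S = s ^ n"
  define P where "P = qpoch (- s) s n"
  define D where "D = qpoch (d * s / b) s n"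
  define U where "U = qpoch (- (b * s)) s n"
  define V where "V = qpoch (d * s) s n"
  define U' where "U' = qpoch (- (b * s\<^sup>2)) s n"
  define V' where "V' = qpoch (d * s\<^sup>2) s n"
  have S2: "(s\<^sup>2) ^ n = S\<^sup>2" by (simp add: S_def power_mult [symmetric] mult.commute)
  have S: "S \<noteq> 0" using assms(1) by (simp add: S_def)
  have U: "U' * (1 + b * s) = U * (1 + b * s * S)" and V: "V' * (1 - d * s) = V * (1 - d * s * S)"
    using qpoch_Suc_shift [of "- (b * s)" s n] qpoch_Suc [of "- (b * s)" s n]
      qpoch_Suc_shift [of "d * s" s n] qpoch_Suc [of "d * s" s n]
    by (simp_all add: U_def U'_def V_def V'_def S_def power2_eq_square mult_ac)
  have bs: "qpoch (b * s) s (Suc n) \<noteq> 0" "qpoch (- (b * s)) s (Suc n) \<noteq> 0"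
    using assms(4) qpoch_square [of "b * s" s "Suc n"] by (auto simp: power_mult_distrib)
  have nz1: "1 - b * s \<noteq> 0" "1 + b * s \<noteq> 0" "U \<noteq> 0" "1 + b * s * S \<noteq> 0"
    using bs qpoch_Suc_shift [of "b * s" s n] qpoch_Suc_shift [of "- (b * s)" s n]
      qpoch_Suc [of "- (b * s)" s n]
    by (auto simp: U_def S_def)
  have ds: "1 - d * s * s ^ k \<noteq> 0" if "k < 2 * Suc n" for k
    using assms(3) that by (auto simp: qpoch_eq_0_iff)
  have nz2: "1 - d * s \<noteq> 0" "1 - d * s\<^sup>2 \<noteq> 0" "1 - d * s * S \<noteq> 0" "1 - d * s\<^sup>2 * S\<^sup>2 \<noteq> 0"
    using ds [of 0] ds [of 1] ds [of n] ds [of "2 * n + 1"]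
    by (simp_all add: S_def power2_eq_square power_add mult_2 mult_2_right mult_ac)
  have "V \<noteq> 0"
    unfolding V_def using assms(3) by (rule qpoch_nonzero_mono) simp
  note nz = nz1 nz2 S assms(1,2) this
  have U': "U' = U * (1 + b * s * S) / (1 + b * s)" and V': "V' = V * (1 - d * s * S) / (1 - d * s)"
    using U V nz by (simp_all add: divide_simps)
  have "s\<^sup>2 * (inverse ((s\<^sup>2) ^ Suc n) - d\<^sup>2 * (s\<^sup>2) ^ Suc n) * (1 - b) * (1 - b * s) /
        ((1 - d * s) * (1 - d * s * s) * (1 - b\<^sup>2 * s\<^sup>2)) =
      (1 - d * s\<^sup>2 * S\<^sup>2) * (1 + d * s\<^sup>2 * S\<^sup>2) * (1 - b) /
        (S\<^sup>2 * (1 - d * s) * (1 - d * s\<^sup>2) * (1 + b * s))" (is "?K = ?K'")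
  proof -
    have 1: "s\<^sup>2 * (inverse ((s\<^sup>2) ^ Suc n) - d\<^sup>2 * (s\<^sup>2) ^ Suc n) =
        (1 - d * s\<^sup>2 * S\<^sup>2) * (1 + d * s\<^sup>2 * S\<^sup>2) / S\<^sup>2"
      unfolding power_Suc S2 using nz by (simp add: field_simps power2_eq_square)
    have 2: "1 - b\<^sup>2 * s\<^sup>2 = (1 - b * s) * (1 + b * s)"
      by (simp add: algebra_simps power2_eq_square)
    show ?thesis
      unfolding 1 2 using nz by (simp add: divide_simps power2_eq_square mult_ac)
  qed
  moreover have "value_b2 s n (b * s\<^sup>2) (d * s\<^sup>2) = b ^ n * P * D / (U * V) *
      (S\<^sup>2 * (1 - d * s\<^sup>2) * (1 + b * s) * (1 - d * s) /
      ((1 - d * s\<^sup>2 * S\<^sup>2) * (1 + b * s * S) * (1 - d * s * S)))" (is "?C = _ * ?C'")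
  proof -
    have "d * s\<^sup>2 * s / (b * s\<^sup>2) = d * s / b"
      using nz by simp
    then have "?C = b ^ n * S\<^sup>2 * (1 - d * s\<^sup>2) * (P * D) / ((1 - d * s\<^sup>2 * S\<^sup>2) * (U' * V'))"
      by (simp add: value_b2_def P_def D_def U'_def V'_def power_mult_distrib S2 mult_ac)
    then show ?thesis
      unfolding U' V' using nz by (simp add: divide_simps) (simp add: mult_ac)
  qed
  moreover have "value_b2q s n b d = b ^ n * P * D / (U * V)"
    by (simp add: value_b2q_def P_def D_def U_def V_def)
  moreover have "value_b2q s (Suc n) b d = b ^ n * P * D / (U * V) *
      ((1 + s * S) * (b - d * s * S) / ((1 + b * s * S) * (1 - d * s * S)))"
  proof -
    have 1: "qpoch (d * s / b) s (Suc n) = D * (b - d * s * S) / b"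
      using assms(2) by (simp add: qpoch_Suc D_def S_def divide_simps)
    have 2: "qpoch (- s) s (Suc n) = P * (1 + s * S)"
      "qpoch (- (b * s)) s (Suc n) = U * (1 + b * s * S)"
      "qpoch (d * s) s (Suc n) = V * (1 - d * s * S)"
      by (simp_all add: qpoch_Suc P_def U_def V_def S_def)
    show ?thesis
      unfolding value_b2q_def 1 2 using nz by (simp add: divide_simps)
  qed
  moreover have "(1 + s * S) * (b - d * s * S) / ((1 + b * s * S) * (1 - d * s * S)) = 1 - ?K' * ?C'"
  proof -
    have "?K' * ?C' = (1 + d * s\<^sup>2 * S\<^sup>2) * (1 - b) / ((1 + b * s * S) * (1 - d * s * S))"
      using nz by (simp add: divide_simps)
    moreover have "(1 + s * S) * (b - d * s * S) =
        (1 + b * s * S) * (1 - d * s * S) - (1 + d * s\<^sup>2 * S\<^sup>2) * (1 - b)"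
      by (simp add: algebra_simps power2_eq_square)
    ultimately show ?thesis
      using nz by (simp add: diff_divide_distrib)
  qed
  moreover have "b ^ n * P * D / (U * V) * (1 - ?K' * ?C') =
      b ^ n * P * D / (U * V) - ?K' * (b ^ n * P * D / (U * V) * ?C')"
    by (simp only: right_diff_distrib mult_1_right mult.left_commute)
  ultimately show ?thesis
    by (simp only:)
qed

text \<open>
  With \<open>T = s\<^sup>n\<^sup>+\<^sup>1\<close> all three summands are multiples of one expression \<open>Z\<close>, and the relation
  becomes \<open>T (1 - d) = (1 - d T\<^sup>2) - (1 - T) (1 + d T)\<close>.
\<close>
lemma value_b2_Suc:
  assumes "s \<noteq> 0" "b \<noteq> 0" "qpoch d s (2 * Suc n + 1) \<noteq> 0" "qpoch (b\<^sup>2) (s\<^sup>2) (Suc n) \<noteq> 0"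
  shows "value_b2 s (Suc n) b d = value_b2q s (Suc n) (b / s) (d / s)
    + s\<^sup>2 * (b / s - d) * (1 - inverse ((s\<^sup>2) ^ Suc n)) * (1 - d\<^sup>2 * (s\<^sup>2) ^ Suc n) * (1 - b) /
        ((1 - d) * (1 - d * s) * (1 - d * s\<^sup>2) * (1 - b\<^sup>2)) *
      value_b2 s n (b * s) (d * s\<^sup>2)"
proof -
  define T where "T = s ^ Suc n"
  define P where "P = qpoch (- s) s n"
  define D where "D = qpoch (d * s\<^sup>2 / b) s n"
  define U where "U = qpoch (- (b * s)) s n"
  define V where "V = qpoch (d * s\<^sup>2) s n"
  have T2: "(s\<^sup>2) ^ Suc n = T\<^sup>2"
    by (simp only: T_def power_mult [symmetric] mult.commute)
  have "qpoch b s (Suc n) \<noteq> 0" "qpoch (- b) s (Suc n) \<noteq> 0"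
    using assms(4) qpoch_square [of b s "Suc n"] by auto
  then have nz1: "1 - b \<noteq> 0" "1 + b \<noteq> 0" "U \<noteq> 0"
    by (auto simp: qpoch_Suc_shift U_def)
  have ds: "1 - d * s ^ k \<noteq> 0" if "k < 2 * Suc n + 1" for k
    using assms(3) that by (auto simp: qpoch_eq_0_iff)
  have nz2: "1 - d \<noteq> 0" "1 - d * s \<noteq> 0" "1 - d * s\<^sup>2 \<noteq> 0" "1 - d * T \<noteq> 0" "1 - d * T\<^sup>2 \<noteq> 0"
    using ds [of 0] ds [of 1] ds [of 2] ds [of "Suc n"] ds [of "2 * Suc n"]
    unfolding T_def power_mult [symmetric] mult.commute [of "Suc n"] by simp_all
  have "qpoch d s (Suc (Suc n)) \<noteq> 0"
    using assms(3) by (rule qpoch_nonzero_mono) simp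
  then have "V \<noteq> 0"
    by (auto simp: V_def qpoch_Suc_shift power2_eq_square mult.assoc)
  moreover have "T \<noteq> 0"
    using assms(1) by (simp add: T_def)
  ultimately have nz: "V \<noteq> 0" "T \<noteq> 0" by auto
  note nz = this nz1 nz2 assms(1,2)
  have P': "qpoch (- s) s (Suc n) = P * (1 + T)"
    by (simp add: P_def T_def qpoch_Suc)
  have D': "qpoch (d * s / b) s (Suc n) = (1 - d * s / b) * D"
    by (simp add: D_def qpoch_Suc_shift power2_eq_square mult_ac)
  have U': "qpoch (- b) s (Suc n) = (1 + b) * U"
    by (simp add: U_def qpoch_Suc_shift)
  have "qpoch d s (Suc n) * (1 - d * T) = (1 - d) * (1 - d * s) * V"
    using qpoch_Suc [of d s "Suc n"] qpoch_Suc_shift [of d s "Suc n"] qpoch_Suc_shift [of "d * s" s n]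
    by (simp add: T_def V_def power2_eq_square mult_ac)
  then have V': "qpoch d s (Suc n) = (1 - d) * (1 - d * s) * V / (1 - d * T)"
    using nz by (simp add: divide_simps)
  define Z where "Z = b ^ Suc n * P * D / (U * V) *
    ((1 + T) * (1 - d * s / b) * (1 - d * T) / ((1 + b) * (1 - d * s)))"
  have "value_b2 s (Suc n) b d = Z / (1 - d * T\<^sup>2)"
    unfolding value_b2_def T2 P' D' U' V' Z_def using nz
    by (simp add: divide_simps) (simp add: mult_ac)
  moreover have "value_b2q s (Suc n) (b / s) (d / s) = Z / (T * (1 - d))"
  proof -
    have 1: "d / s * s / (b / s) = d * s / b" "b / s * s = b" "d / s * s = d" "d / (b / s) = d * s / b"
      using nz by simp_all
    have 2: "(b / s) ^ Suc n = b ^ Suc n / T"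
      unfolding T_def by (rule power_divide)
    show ?thesis
      unfolding value_b2q_def 1 2 P' D' U' V' Z_def using nz
      by (simp add: divide_simps)
  qed
  moreover have "s\<^sup>2 * (b / s - d) * (1 - inverse ((s\<^sup>2) ^ Suc n)) * (1 - d\<^sup>2 * (s\<^sup>2) ^ Suc n) * (1 - b) /
        ((1 - d) * (1 - d * s) * (1 - d * s\<^sup>2) * (1 - b\<^sup>2)) *
      value_b2 s n (b * s) (d * s\<^sup>2) =
    - (Z * (1 - T) * (1 + d * T) / (T * (1 - d) * (1 - d * T\<^sup>2)))"
  proof -
    have 1: "s\<^sup>2 * (b / s - d) = b * s * (1 - d * s / b)"
      using nz by (simp add: field_simps power2_eq_square)
    have 2: "1 - inverse ((s\<^sup>2) ^ Suc n) = - ((1 - T) * (1 + T) / T\<^sup>2)"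
      unfolding T2 using nz by (simp add: field_simps power2_eq_square)
    have 3: "1 - d\<^sup>2 * (s\<^sup>2) ^ Suc n = (1 - d * T) * (1 + d * T)" "1 - b\<^sup>2 = (1 - b) * (1 + b)"
      unfolding T2 by (simp_all add: algebra_simps power2_eq_square)
    have 4: "value_b2 s n (b * s) (d * s\<^sup>2) =
        b ^ Suc n * T * (1 - d * s\<^sup>2) * P * D / (b * s * (1 - d * T\<^sup>2) * U * V)"
    proof -
      have a: "d * s\<^sup>2 * s / (b * s) = d * s\<^sup>2 / b"
        using nz by (simp add: power2_eq_square)
      have b: "(s\<^sup>2) ^ n * (d * s\<^sup>2) = d * T\<^sup>2"
        using T2 by (simp add: mult_ac)
      have c: "(b * s) ^ n = b ^ Suc n * T / (b * s)"
        using nz by (simp add: T_def power_mult_distrib)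
      show ?thesis
        unfolding value_b2_def a b c P_def [symmetric] D_def [symmetric] U_def [symmetric] V_def [symmetric]
        by (simp add: mult_ac)
    qed
    show ?thesis
      unfolding 1 2 3 4 Z_def using nz
      by (simp add: divide_simps) (simp add: power2_eq_square)
  qed
  moreover have "Z / (1 - d * T\<^sup>2) = Z / (T * (1 - d)) +
      - (Z * (1 - T) * (1 + d * T) / (T * (1 - d) * (1 - d * T\<^sup>2)))"
    using nz by (simp add: divide_simps) (simp add: algebra_simps power2_eq_square)
  ultimately show ?thesis
    by simp
qed

section \<open>Evaluation of the series\<close>

text \<open>
  Simultaneous induction for all \<open>b\<close> and \<open>d\<close>.  At stage \<open>n + 1\<close> the second family comes first, because
  the first one is reduced to it at the same \<open>n + 1\<close>.  For the first family the single condition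
  \<open>(d;s)\<^sub>2\<^sub>n\<^sub>+\<^sub>1 \<noteq> 0\<close> combines the denominators \<open>(d q;q)\<^sub>n (d s;q)\<^sub>n\<close>, \<open>(d;s)\<^sub>n\<close> and
  \<open>1 - q\<^sup>n d\<close>.
\<close>
lemma quad_sum_values:
  assumes "s \<noteq> 0"
  shows
    "\<And>b d. qpoch (s\<^sup>2) (s\<^sup>2) n \<noteq> 0 \<Longrightarrow> b \<noteq> 0 \<Longrightarrow> qpoch d s (2 * n + 1) \<noteq> 0 \<Longrightarrow> qpoch (b\<^sup>2) (s\<^sup>2) n \<noteq> 0 \<Longrightarrow>
       quad_sum s n (d\<^sup>2 * (s\<^sup>2) ^ n) b (d * s) (b\<^sup>2) = value_b2 s n b d"
    "\<And>b d. qpoch (s\<^sup>2) (s\<^sup>2) n \<noteq> 0 \<Longrightarrow> b \<noteq> 0 \<Longrightarrow> qpoch (d * s) s (2 * n) \<noteq> 0 \<Longrightarrow> qpoch (b\<^sup>2 * s\<^sup>2) (s\<^sup>2) n \<noteq> 0 \<Longrightarrow>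
       quad_sum s n (d\<^sup>2 * (s\<^sup>2) ^ Suc n) b (d * s) (b\<^sup>2 * s\<^sup>2) = value_b2q s n b d"
proof (induction n)
  case 0
  { case 1 then show ?case by (simp add: quad_sum_def value_b2_def qpoch_def) }
  { case 2 then show ?case by (simp add: quad_sum_def value_b2q_def) }
next
  case (Suc n)
  have C2: "quad_sum s (Suc n) (d\<^sup>2 * (s\<^sup>2) ^ Suc (Suc n)) b (d * s) (b\<^sup>2 * s\<^sup>2) = value_b2q s (Suc n) b d"
    if q: "qpoch (s\<^sup>2) (s\<^sup>2) (Suc n) \<noteq> 0" and that: "b \<noteq> 0" "qpoch (d * s) s (2 * Suc n) \<noteq> 0" "qpoch (b\<^sup>2 * s\<^sup>2) (s\<^sup>2) (Suc n) \<noteq> 0" for b d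
  proof -
    have q': "qpoch (s\<^sup>2) (s\<^sup>2) n \<noteq> 0"
      using q by (rule qpoch_nonzero_mono) simp
    have "quad_sum s n (d\<^sup>2 * (s\<^sup>2) ^ Suc n) b (d * s) (b\<^sup>2 * s\<^sup>2) = value_b2q s n b d"
      using that by (intro Suc.IH q') (auto elim!: qpoch_nonzero_mono)
    moreover have "quad_sum s n (d\<^sup>2 * (s\<^sup>2) ^ Suc n * s\<^sup>2) (b * s\<^sup>2) (d * s * s\<^sup>2) (b\<^sup>2 * s\<^sup>2 * s\<^sup>2) =
        value_b2 s n (b * s\<^sup>2) (d * s\<^sup>2)"
    proof -
      have "qpoch (d * s\<^sup>2) s (2 * n + 1) \<noteq> 0" "qpoch ((b * s\<^sup>2)\<^sup>2) (s\<^sup>2) n \<noteq> 0"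
        using that assms(1) qpoch_Suc_shift [of "d * s" s "2 * n + 1"] qpoch_Suc_shift [of "b\<^sup>2 * s\<^sup>2" "s\<^sup>2" n]
        by (auto simp: power2_eq_square mult_ac)
      from Suc.IH(1) [OF q' _ this] that assms(1) show ?thesis
        by (simp add: power2_eq_square mult_ac)
    qed
    moreover have "quad_sum s (Suc n) (d\<^sup>2 * (s\<^sup>2) ^ Suc n * s\<^sup>2) b (d * s) (b\<^sup>2 * s\<^sup>2) =
      quad_sum s n (d\<^sup>2 * (s\<^sup>2) ^ Suc n) b (d * s) (b\<^sup>2 * s\<^sup>2)
      - s\<^sup>2 * (inverse ((s\<^sup>2) ^ Suc n) - d\<^sup>2 * (s\<^sup>2) ^ Suc n) * (1 - b) * (1 - b * s) /
        ((1 - d * s) * (1 - d * s * s) * (1 - b\<^sup>2 * s\<^sup>2)) *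
      quad_sum s n (d\<^sup>2 * (s\<^sup>2) ^ Suc n * s\<^sup>2) (b * s\<^sup>2) (d * s * s\<^sup>2) (b\<^sup>2 * s\<^sup>2 * s\<^sup>2)"
      using q that assms(1) by (intro quad_sum_contiguous_na)
    moreover have "d\<^sup>2 * (s\<^sup>2) ^ Suc (Suc n) = d\<^sup>2 * (s\<^sup>2) ^ Suc n * s\<^sup>2"
      by simp
    ultimately show ?thesis
      using value_b2q_Suc [OF assms(1) that] by (simp only:)
  qed
  {
    case (1 b d)
    have q': "qpoch (s\<^sup>2) (s\<^sup>2) n \<noteq> 0"
      using 1(1) by (rule qpoch_nonzero_mono) simp
    have "d / s * s = d" "b / s * s\<^sup>2 = b * s" "(b / s)\<^sup>2 * s\<^sup>2 = b\<^sup>2"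
      "(d / s)\<^sup>2 * (s\<^sup>2) ^ Suc (Suc n) = d\<^sup>2 * (s\<^sup>2) ^ Suc n"
      using assms(1) by (simp_all add: power2_eq_square)
    moreover have "quad_sum s (Suc n) ((d / s)\<^sup>2 * (s\<^sup>2) ^ Suc (Suc n)) (b / s) (d / s * s)
        ((b / s)\<^sup>2 * s\<^sup>2) = value_b2q s (Suc n) (b / s) (d / s)"
      using 1 assms(1) by (intro C2) (auto elim!: qpoch_nonzero_mono simp: power2_eq_square)
    moreover have "quad_sum s n (d\<^sup>2 * (s\<^sup>2) ^ Suc n * s\<^sup>2) (b * s) (d * s ^ 3) (b\<^sup>2 * s\<^sup>2) =
        value_b2 s n (b * s) (d * s\<^sup>2)"
    proof -
      have "qpoch (d * s\<^sup>2) s (2 * n + 1) \<noteq> 0" "qpoch ((b * s)\<^sup>2) (s\<^sup>2) n \<noteq> 0"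
        using 1 qpoch_Suc_shift [of d s "2 * n + 2"] qpoch_Suc_shift [of "d * s" s "2 * n + 1"]
          qpoch_Suc_shift [of "b\<^sup>2" "s\<^sup>2" n]
        by (auto simp: power2_eq_square mult_ac)
      from Suc.IH(1) [OF q' _ this] 1 assms(1) show ?thesis
        by (simp add: power2_eq_square power3_eq_cube mult_ac)
    qed
    moreover have "quad_sum s (Suc n) (d\<^sup>2 * (s\<^sup>2) ^ Suc n) (b / s * s) (d * s) (b\<^sup>2) =
      quad_sum s (Suc n) (d\<^sup>2 * (s\<^sup>2) ^ Suc n) (b / s) d (b\<^sup>2)
      + s\<^sup>2 * (b / s - d) * (1 - inverse ((s\<^sup>2) ^ Suc n)) * (1 - d\<^sup>2 * (s\<^sup>2) ^ Suc n) * (1 - b / s * s) /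
          ((1 - d) * (1 - d * s) * (1 - d * s\<^sup>2) * (1 - b\<^sup>2)) *
        quad_sum s n (d\<^sup>2 * (s\<^sup>2) ^ Suc n * s\<^sup>2) (b / s * s\<^sup>2) (d * s ^ 3) (b\<^sup>2 * s\<^sup>2)"
      using 1 assms(1)
      by (intro quad_sum_contiguous_be) (auto simp: numeral_3_eq_3)
    moreover have "b / s * s = b"
      using assms(1) by simp
    ultimately show ?case
      using value_b2_Suc [OF assms(1) 1(2-4)] by (simp only:)
  }
  {
    case 2
    then show ?case by (intro C2)
  }
qed

lemma basic_hyp_eq_quad_sum:
  assumes "s \<noteq> 0"
  shows "basic_hyp [(s\<^sup>2) powi (- int n), b, b * s, a] [d * s\<^sup>2, d * s, c] (s\<^sup>2) (s\<^sup>2) =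
    quad_sum s n a b (d * s) c"
proof -
  have "basic_hyp [(s\<^sup>2) powi (- int n), b, b * s, a] [d * s\<^sup>2, d * s, c] (s\<^sup>2) (s\<^sup>2) =
    (\<Sum>j\<le>n. qpochs [(s\<^sup>2) powi (- int n), b, b * s, a] (s\<^sup>2) j /
      qpochs [s\<^sup>2, d * s\<^sup>2, d * s, c] (s\<^sup>2) j * (s\<^sup>2) ^ j)"
    using assms by (intro basic_hyp_terminating) auto
  also have "\<dots> = quad_sum s n a b (d * s) c"
    unfolding quad_sum_def quad_term_def qpoch_double
    by (intro sum.cong) (simp_all add: qpochs_def power_int_minus power2_eq_square mult_ac)
  finally show ?thesis .
qed

theorem theorem1p6:
  fixes n :: nat and q s b d :: complex
  assumes "q \<noteq> 0" and "b \<noteq> 0" and "d \<noteq> 0" and "s ^ 2 = q"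
  shows
    "((\<forall>j\<le>n. qpochs [q, d * q, d * s, b ^ 2] q j \<noteq> 0) \<and>
      (1 - q ^ n * d) * qpochs [- b, d] s n \<noteq> 0 \<longrightarrow>
      basic_hyp [q powi (- int n), b, b * s, d ^ 2 * q ^ n] [d * q, d * s, b ^ 2] q q =
        b ^ n * (1 - d) * qpochs [- s, d * s / b] s n /
        ((1 - q ^ n * d) * qpochs [- b, d] s n)) \<and>
     ((\<forall>j\<le>n. qpochs [q, d * q, d * s, b ^ 2 * q] q j \<noteq> 0) \<and>
      qpochs [- (b * s), d * s] s n \<noteq> 0 \<longrightarrow>
      basic_hyp [q powi (- int n), b, b * s, d ^ 2 * q ^ (n + 1)] [d * q, d * s, b ^ 2 * q] q q =
        b ^ n * qpochs [- s, d * s / b] s n /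
        qpochs [- (b * s), d * s] s n)"
proof (intro conjI impI)
  have s: "s \<noteq> 0" and q: "q = s\<^sup>2" using assms by auto
  {
    assume *: "(\<forall>j\<le>n. qpochs [q, d * q, d * s, b ^ 2] q j \<noteq> 0) \<and>
      (1 - q ^ n * d) * qpochs [- b, d] s n \<noteq> 0"
    have den: "qpochs [q, d * q, d * s, b ^ 2] q n \<noteq> 0"
      using * by blast
    then have nz: "qpoch (s\<^sup>2) (s\<^sup>2) n \<noteq> 0" "qpoch (d * s) s (2 * n) \<noteq> 0" "qpoch (b\<^sup>2) (s\<^sup>2) n \<noteq> 0"
      using qpoch_double [of "d * s" s n]
      by (auto simp: qpochs_def q power2_eq_square mult_ac)
    \<comment> \<open>For \<open>n = 0\<close> the factor \<open>1 - d\<close> is \<open>1 - q ^ n * d\<close>; otherwise it is the first factor of \<open>qpoch d s n\<close>.\<close>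
    have "1 - d \<noteq> 0"
      using * by (cases n) (auto simp: qpochs_def qpoch_Suc_shift)
    then have "qpoch d s (2 * n + 1) \<noteq> 0"
      using nz(2) by (simp add: qpoch_Suc_shift)
    from quad_sum_values(1) [OF s nz(1) assms(2) this nz(3)]
    show "basic_hyp [q powi (- int n), b, b * s, d ^ 2 * q ^ n] [d * q, d * s, b ^ 2] q q =
        b ^ n * (1 - d) * qpochs [- s, d * s / b] s n /
        ((1 - q ^ n * d) * qpochs [- b, d] s n)"
      unfolding q basic_hyp_eq_quad_sum [OF s] by (simp add: qpochs_def value_b2_def)
  next
    assume *: "(\<forall>j\<le>n. qpochs [q, d * q, d * s, b ^ 2 * q] q j \<noteq> 0) \<and>
      qpochs [- (b * s), d * s] s n \<noteq> 0"
    have den: "qpochs [q, d * q, d * s, b ^ 2 * q] q n \<noteq> 0"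
      using * by blast
    then have nz: "qpoch (s\<^sup>2) (s\<^sup>2) n \<noteq> 0" "qpoch (d * s) s (2 * n) \<noteq> 0"
      "qpoch (b\<^sup>2 * s\<^sup>2) (s\<^sup>2) n \<noteq> 0"
      using qpoch_double [of "d * s" s n]
      by (auto simp: qpochs_def q power2_eq_square mult_ac)
    from quad_sum_values(2) [OF s nz(1) assms(2) nz(2,3)]
    show "basic_hyp [q powi (- int n), b, b * s, d ^ 2 * q ^ (n + 1)] [d * q, d * s, b ^ 2 * q] q q =
        b ^ n * qpochs [- s, d * s / b] s n /
        qpochs [- (b * s), d * s] s n"
      unfolding q basic_hyp_eq_quad_sum [OF s] by (simp add: qpochs_def value_b2q_def)
  }
qed

end
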